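(* Let $\lambda$ be the solution of the spatial coagulation equation described in the context, and assume the moment-control condition (A1) stated there, with associated $T_1>0$. Put $$p(x):=\sum_{y\in\mathcal S}\lambda_0(1,y)\,G(x,y),\qquad g_k(x,t):=\frac1k\sum_{y\in\mathcal S}G(x,y)\sum_{j=1}^{k-1}j^2(k-j)\,\lambda_t(j,x)\lambda_t(k-j,y).$$ Then for each $k\ge1$ and $x\in\mathcal S$, $\lambda_t(k,x)$ satisfies the non-homogeneous linear differential equation $$\frac{d}{dt}\lambda_t(k,x)+k\,p(x)\lambda_t(k,x)=g_k(x,t),\qquad t\in[0,T_1).$$ In particular, the solution is recursively given, for $t\in[0,T_1)$, by $$\lambda_t(k,x)=e^{-ktp(x)}\Bigl(\lambda_0(k,x)+\int_0^t e^{ksp(x)}\,g_k(x,s)\,ds\Bigr),\qquad k\ge1.$$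
   Context: Setting. $\mathcal S$ is a finite or countably infinite set, and $G:\mathcal S\times\mathcal S\to(0,\infty)$ is a uniformly bounded function (the spatial kernel). $\mathbb N=\{1,2,\dots\}$. One considers densities $\lambda_t(i,x)\ge0$, $i\in\mathbb N$, $x\in\mathcal S$, solving $$\frac{d}{dt}\lambda_t(i,x)=\sum_{y\in\mathcal S}\sum_{j=1}^{i-1}\frac{j}{i}\,j(i-j)\,G(x,y)\lambda_t(j,x)\lambda_t(i-j,y)-i\,\lambda_t(i,x)\sum_{y\in\mathcal S}\sum_{j\ge1}j\,G(x,y)\lambda_t(j,y),$$ with monodisperse normalised initial condition: $\sum_{i\ge1}i\lambda_0(i,x)=\lambda_0(1,x)$ for every $x$ (so $\lambda_0(i,x)=0$ for $i\ge2$) and $\sum_{x\in\mathcal S}\lambda_0(1,x)=1$. Moments: $m_k(x,t)=\sum_{i\ge1}i^k\lambda_t(i,x)$ and $M_k(t)=\sum_{x\in\mathcal S}m_k(x,t)$, $k\in\mathbb N$. Gelation time: $t_{\mathrm{gel}}=\sup\{t>0: M_2(t)<\infty\}\in(0,\infty]$. The solution $\lambda$ is the (unique) solution up to the gelation time, i.e. on $[0,t_{\mathrm{gel}})$, with $M_2$ bounded on compact subintervals of $[0,t_{\mathrm{gel}})$, and, if $t_{\mathrm{gel}}<\infty$, $M_2(t)\to\infty$ as $t\uparrow t_{\mathrm{gel}}$; this is a standing fact about the solution. Moment-control condition (A1). There is $T_1>0$ (with $[0,T_1)$ contained in the interval $[0,t_{\mathrm{gel}})$ of existence) such that for every $x\in\mathcal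 S$ the series $\sum_{y\in\mathcal S}G(x,y)m_2(x,t)m_1(y,t)$ converges uniformly in $t\in[0,T_1)$. *)

theory Defs
  imports "HOL-Analysis.Analysis"
begin

definition spatial_kernel :: "'a set \<Rightarrow> ('a \<Rightarrow> 'a \<Rightarrow> real) \<Rightarrow> bool" where
  "spatial_kernel S G \<longleftrightarrow>
     (\<forall>x\<in>S. \<forall>y\<in>S. 0 < G x y) \<and> (\<exists>C. \<forall>x\<in>S. \<forall>y\<in>S. G x y \<le> C)"

text \<open>
  Throughout, \<open>L t i x\<close> is the density of particles of mass \<open>i \<ge> 1\<close> at site \<open>x\<close> and time \<open>t\<close>.
  The moments take values in \<open>[0, \<infinity>]\<close>, so that divergence is visible.
\<close>

definition site_moment :: "(real \<Rightarrow> nat \<Rightarrow> 'a \<Rightarrow> real) \<Rightarrow> nat \<Rightarrow> 'a \<Rightarrow> real \<Rightarrow> ennreal" where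
  "site_moment L k x t = (\<Sum>\<^sub>\<infinity>i\<in>{1..}. ennreal (real i ^ k * L t i x))"

definition total_moment ::
    "'a set \<Rightarrow> (real \<Rightarrow> nat \<Rightarrow> 'a \<Rightarrow> real) \<Rightarrow> nat \<Rightarrow> real \<Rightarrow> ennreal" where
  "total_moment S L k t = (\<Sum>\<^sub>\<infinity>x\<in>S. site_moment L k x t)"

definition gel_time :: "'a set \<Rightarrow> (real \<Rightarrow> nat \<Rightarrow> 'a \<Rightarrow> real) \<Rightarrow> ereal" where
  "gel_time S L = Sup {ereal t |t. 0 < t \<and> total_moment S L 2 t < \<infinity>}"

definition coag_gain ::
    "'a set \<Rightarrow> ('a \<Rightarrow> 'a \<Rightarrow> real) \<Rightarrow> (real \<Rightarrow> nat \<Rightarrow> 'a \<Rightarrow> real) \<Rightarrow> nat \<Rightarrow> 'a \<Rightarrow> real \<Rightarrow> real" where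
  "coag_gain S G L i x t =
     (\<Sum>\<^sub>\<infinity>y\<in>S. \<Sum>j=1..<i.
        real j / real i * (real j * real (i - j)) * G x y * L t j x * L t (i - j) y)"

definition coag_loss ::
    "'a set \<Rightarrow> ('a \<Rightarrow> 'a \<Rightarrow> real) \<Rightarrow> (real \<Rightarrow> nat \<Rightarrow> 'a \<Rightarrow> real) \<Rightarrow> nat \<Rightarrow> 'a \<Rightarrow> real \<Rightarrow> real" where
  "coag_loss S G L i x t =
     real i * L t i x * (\<Sum>\<^sub>\<infinity>y\<in>S. \<Sum>\<^sub>\<infinity>j\<in>{1..}. real j * G x y * L t j y)"

definition monodisperse_init :: "'a set \<Rightarrow> (real \<Rightarrow> nat \<Rightarrow> 'a \<Rightarrow> real) \<Rightarrow> bool" where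
  "monodisperse_init S L \<longleftrightarrow>
     (\<forall>x\<in>S. site_moment L 1 x 0 = ennreal (L 0 1 x)) \<and> ((\<lambda>x. L 0 1 x) has_sum 1) S"

text \<open>
  A solution up to gelation. Only the times in \<open>[0, gel_time S L)\<close> are constrained; a density that
  is only given on \<open>[0, T)\<close> is represented by any extension with infinite second moment from
  \<open>T\<close> on. The derivative within \<open>{0..}\<close> is one-sided at time \<open>0\<close> and two-sided at positive times.
  All real infinite sums in the equation converge, since the second moment is finite before
  gelation and the kernel is bounded.
\<close>

definition coag_solution ::
    "'a set \<Rightarrow> ('a \<Rightarrow> 'a \<Rightarrow> real) \<Rightarrow> (real \<Rightarrow> nat \<Rightarrow> 'a \<Rightarrow> real) \<Rightarrow> bool" where
  "coag_solution S G L \<longleftrightarrow>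
     0 < gel_time S L \<and>
     (\<forall>t\<ge>0. ereal t < gel_time S L \<longrightarrow> (\<forall>i\<ge>1. \<forall>x\<in>S. 0 \<le> L t i x)) \<and>
     (\<forall>t\<ge>0. ereal t < gel_time S L \<longrightarrow> (\<forall>i\<ge>1. \<forall>x\<in>S.
        ((\<lambda>s. L s i x) has_real_derivative coag_gain S G L i x t - coag_loss S G L i x t)
          (at t within {0..}))) \<and>
     monodisperse_init S L \<and>
     (\<forall>a b. 0 \<le> a \<and> a \<le> b \<and> ereal b < gel_time S L \<longrightarrow>
        (\<exists>B<\<infinity>. \<forall>t\<in>{a..b}. total_moment S L 2 t \<le> B)) \<and>
     (gel_time S L < \<infinity> \<longrightarrow>
        (total_moment S L 2 \<longlongrightarrow> \<infinity>) (at_left (real_of_ereal (gel_time S L))))"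

text \<open>
  The terms are nonnegative, so uniform convergence along the net of finite subsets of \<open>S\<close> agrees
  with uniform convergence of the partial sums along any enumeration of \<open>S\<close>.
\<close>

definition moment_control ::
    "'a set \<Rightarrow> ('a \<Rightarrow> 'a \<Rightarrow> real) \<Rightarrow> (real \<Rightarrow> nat \<Rightarrow> 'a \<Rightarrow> real) \<Rightarrow> real \<Rightarrow> bool" where
  "moment_control S G L T1 \<longleftrightarrow>
     0 < T1 \<and> ereal T1 \<le> gel_time S L \<and>
     (\<forall>x\<in>S. uniform_limit {0..<T1}
        (\<lambda>F t. \<Sum>y\<in>F. G x y * enn2real (site_moment L 2 x t) * enn2real (site_moment L 1 y t))
        (\<lambda>t. \<Sum>\<^sub>\<infinity>y\<in>S. G x y * enn2real (site_moment L 2 x t) * enn2real (site_moment L 1 y t))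
        (finite_subsets_at_top S))"

definition coag_rate ::
    "'a set \<Rightarrow> ('a \<Rightarrow> 'a \<Rightarrow> real) \<Rightarrow> (real \<Rightarrow> nat \<Rightarrow> 'a \<Rightarrow> real) \<Rightarrow> 'a \<Rightarrow> real" where
  "coag_rate S G L x = (\<Sum>\<^sub>\<infinity>y\<in>S. L 0 1 y * G x y)"

definition coag_source ::
    "'a set \<Rightarrow> ('a \<Rightarrow> 'a \<Rightarrow> real) \<Rightarrow> (real \<Rightarrow> nat \<Rightarrow> 'a \<Rightarrow> real) \<Rightarrow> nat \<Rightarrow> 'a \<Rightarrow> real \<Rightarrow> real" where
  "coag_source S G L k x t =
     1 / real k * (\<Sum>\<^sub>\<infinity>y\<in>S. G x y *
        (\<Sum>j=1..<k. (real j)\<^sup>2 * real (k - j) * L t j x * L t (k - j) y))"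

end

theory Submission
  imports Defs
begin

text \<open>
  The mass at each site is conserved before gelation. Multiplied by \<open>i\<close>, the gain terms at a site are
  the Cauchy product of \<open>j\<^sup>2 \<lambda>\<^sub>t(j, x)\<close> and \<open>\<Sum>\<^sub>y G(x, y) l \<lambda>\<^sub>t(l, y)\<close>, and the loss terms are
  the first sequence times the sum of the second. Hence the time derivative of the mass in clusters
  of size below \<open>n\<close> tends to 0 as \<open>n\<close> grows, and it is bounded on compact time intervals through
  the second moment; dominated convergence gives \<open>m\<^sub>1(x, t) = \<lambda>\<^sub>0(1, x)\<close>. The loss rate is therefore
  the constant \<open>k p(x)\<close>, and the explicit formula follows with the integrating factor
  \<open>exp (k t p(x))\<close>.
\<close>

section \<open>Infinite sums of nonnegative terms and the second moment\<close>

text \<open>The moments are \<open>ennreal\<close> sums while the equation uses real ones; this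
  carries a finite value from the former to the latter. The \<open>ennreal\<close> sum always
  exists, and on nonnegative reals \<open>ennreal\<close> preserves and reflects limits.\<close>

lemma has_sum_if_infsum_ennreal_eq:
  fixes f :: "'b \<Rightarrow> real"
  assumes "\<And>x. x \<in> A \<Longrightarrow> 0 \<le> f x" and "0 \<le> c"
    and eq: "(\<Sum>\<^sub>\<infinity>x\<in>A. ennreal (f x)) = ennreal c"
  shows "(f has_sum c) A"
proof -
  have "((\<lambda>x. ennreal (f x)) has_sum ennreal c) A"
    unfolding eq[symmetric] by (intro has_sum_infsum nonneg_summable_on_complete) simp
  then have "((\<lambda>F. \<Sum>x\<in>F. ennreal (f x)) \<longlongrightarrow> ennreal c) (finite_subsets_at_top A)"
    by (simp add: has_sum_def)
  moreover have ev: "\<forall>\<^sub>F F in finite_subsets_at_top A. finite F \<and> F \<subseteq> A"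
    by (simp add: eventually_finite_subsets_at_top_weakI)
  then have "\<forall>\<^sub>F F in finite_subsets_at_top A. (\<Sum>x\<in>F. ennreal (f x)) = ennreal (sum f F)"
    by eventually_elim (use assms(1) in \<open>auto intro!: sum_ennreal\<close>)
  ultimately have "((\<lambda>F. ennreal (sum f F)) \<longlongrightarrow> ennreal c) (finite_subsets_at_top A)"
    by (simp add: tendsto_cong)
  moreover have "\<forall>\<^sub>F F in finite_subsets_at_top A. 0 \<le> sum f F"
    using ev by eventually_elim (use assms(1) in \<open>auto intro!: sum_nonneg\<close>)
  ultimately show ?thesis
    using \<open>0 \<le> c\<close> by (simp add: has_sum_def)
qed

lemma has_sum_finite_sum:
  fixes f :: "'i \<Rightarrow> 'b \<Rightarrow> 'c::topological_comm_monoid_add"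
  assumes "finite I" and "\<And>i. i \<in> I \<Longrightarrow> (f i has_sum s i) A"
  shows "((\<lambda>x. \<Sum>i\<in>I. f i x) has_sum (\<Sum>i\<in>I. s i)) A"
  using assms by (induction I rule: finite_induct) (auto intro!: has_sum_add)

text \<open>Tonelli: finite second moments at the sites, themselves summable over the sites, give
  joint summability over sites and sizes. This is what later justifies exchanging the two
  sums.\<close>

lemma second_moment_summable:
  assumes nonneg: "\<And>i y. 1 \<le> i \<Longrightarrow> y \<in> S \<Longrightarrow> 0 \<le> L t i y"
    and bound: "total_moment S L 2 t \<le> ennreal B" and "0 \<le> B"
  shows "(\<lambda>(y, i). (real i)\<^sup>2 * L t i y) summable_on S \<times> {1..}"
    and "(\<Sum>\<^sub>\<infinity>(y, i)\<in>S \<times> {1..}. (real i)\<^sup>2 * L t i y) \<le> B"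
proof -
  define m where "m y = enn2real (site_moment L 2 y t)" for y
  have fin: "site_moment L 2 y t = ennreal (m y)" if "y \<in> S" for y
  proof -
    have "site_moment L 2 y t \<le> total_moment S L 2 t"
    proof -
      \<comment> \<open>The one-point sum makes the moment at \<open>y\<close> comparable with the
        sum over all sites by monotonicity in the index set.\<close>
      have "(\<Sum>\<^sub>\<infinity>x\<in>{y}. site_moment L 2 x t) \<le> (\<Sum>\<^sub>\<infinity>x\<in>S. site_moment L 2 x t)"
        by (rule infsum_mono_neutral) (use that in \<open>auto intro: nonneg_summable_on_complete\<close>)
      then show ?thesis by (simp add: total_moment_def)
    qed
    also have "\<dots> \<le> ennreal B" by fact
    finally have "site_moment L 2 y t < \<infinity>"
      by (simp add: order_le_less_trans)
    then show ?thesis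
      by (simp add: m_def)
  qed
  have site: "((\<lambda>i. (real i)\<^sup>2 * L t i y) has_sum m y) {1..}" if "y \<in> S" for y
  proof (rule has_sum_if_infsum_ennreal_eq)
    show "(\<Sum>\<^sub>\<infinity>i\<in>{1..}. ennreal ((real i)\<^sup>2 * L t i y)) = ennreal (m y)"
      using fin[OF that] by (simp only: site_moment_def)
  qed (use that nonneg in \<open>auto simp: m_def\<close>)
  obtain M where M: "total_moment S L 2 t = ennreal M" "0 \<le> M" "M \<le> B"
    using bound \<open>0 \<le> B\<close> by (cases "total_moment S L 2 t") (auto simp: top_unique)
  have "(\<Sum>\<^sub>\<infinity>y\<in>S. ennreal (m y)) = total_moment S L 2 t"
    unfolding total_moment_def by (rule infsum_cong) (simp add: fin)
  then have total: "(m has_sum M) S"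
    by (intro has_sum_if_infsum_ennreal_eq) (auto simp: m_def M(1,2))
  show summ: "(\<lambda>(y, i). (real i)\<^sup>2 * L t i y) summable_on S \<times> {1..}"
    by (rule summable_on_SigmaI[where g = m])
      (use site total nonneg in \<open>auto simp: has_sum_imp_summable\<close>)
  have "((\<lambda>(y, i). (real i)\<^sup>2 * L t i y) has_sum M) (S \<times> {1..})"
    by (rule has_sum_SigmaI[where g = m]) (use site total summ in auto)
  then show "(\<Sum>\<^sub>\<infinity>(y, i)\<in>S \<times> {1..}. (real i)\<^sup>2 * L t i y) \<le> B"
    using M(3) by (simp add: infsumI)
qed

text \<open>Passes from sums over sizes to series indexed from 0, as the Cauchy product requires;
  the value at 0 must vanish so that nothing is added.\<close>

lemma summable_on_atLeast_1_imp_sums: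
  fixes f :: "nat \<Rightarrow> real"
  assumes "f summable_on {1..}" and "f 0 = 0"
  shows "f sums (\<Sum>\<^sub>\<infinity>i\<in>{1..}. f i)"
proof -
  have "(f has_sum (\<Sum>\<^sub>\<infinity>i\<in>{1..}. f i)) UNIV"
    using has_sum_cong_neutral[of UNIV "{1..}" f f] has_sum_infsum[OF assms(1)] assms(2)
    by (metis Compl_eq_Diff_UNIV Diff_eq_empty_iff Diff_iff One_nat_def Suc_leI atLeast_iff
        empty_iff gr0I top_greatest)
  then show ?thesis by (rule has_sum_imp_sums)
qed

section \<open>Conservation of the mass at each site\<close>

text \<open>Both terms of \<open>d n\<close> converge to \<open>A * C\<close>, the first by the
  Cauchy product theorem. Both also lie between 0 and \<open>A * C\<close>, which bounds their
  difference uniformly in \<open>n\<close>.\<close>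

lemma Cauchy_product_truncation:
  fixes a c :: "nat \<Rightarrow> real"
  assumes nonneg: "\<And>i. 0 \<le> a i" "\<And>i. 0 \<le> c i"
    and "a sums A" and "c sums C"
  defines "d \<equiv> \<lambda>n. (\<Sum>i<n. \<Sum>j\<le>i. a j * c (i - j)) - (\<Sum>i<n. a i) * C"
  shows "d \<longlonglongrightarrow> 0" and "\<bar>d n\<bar> \<le> A * C"
proof -
  have prod: "(\<lambda>i. \<Sum>j\<le>i. a j * c (i - j)) sums (A * C)"
    using Cauchy_product_sums[of a c] assms by (simp add: sums_iff)
  have "d \<longlonglongrightarrow> A * C - A * C"
    unfolding d_def using prod \<open>a sums A\<close> unfolding sums_def by (intro tendsto_intros)
  then show "d \<longlonglongrightarrow> 0" by simp
  have "0 \<le> C" using \<open>c sums C\<close> nonneg by (metis sums_iff suminf_nonneg)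
  have "(\<Sum>i<n. \<Sum>j\<le>i. a j * c (i - j)) \<le> A * C"
    using prod nonneg by (intro sum_le_suminf[of _ "{..<n}", THEN order_trans])
      (auto simp: sums_iff intro!: sum_nonneg)
  moreover have "0 \<le> (\<Sum>i<n. \<Sum>j\<le>i. a j * c (i - j))"
    using nonneg by (intro sum_nonneg) auto
  moreover have "(\<Sum>i<n. a i) \<le> A"
    using \<open>a sums A\<close> nonneg by (metis finite_lessThan sum_le_suminf sums_iff)
  then have "(\<Sum>i<n. a i) * C \<le> A * C"
    using \<open>0 \<le> C\<close> by (rule mult_right_mono)
  moreover have "0 \<le> (\<Sum>i<n. a i) * C"
    using nonneg \<open>0 \<le> C\<close> by (intro mult_nonneg_nonneg sum_nonneg) auto
  ultimately show "\<bar>d n\<bar> \<le> A * C" unfolding d_def by linarith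
qed

text \<open>With \<open>a\<close> the second-moment terms at \<open>x\<close> and \<open>c\<close>
  the kernel-weighted mass terms, \<open>d\<close> is the difference of the previous lemma. The sums
  of \<open>a\<close> and \<open>c\<close> are at most \<open>B\<close> and \<open>C * B\<close>, so
  the bound depends on \<open>t\<close> only through \<open>B\<close>.\<close>

lemma truncated_mass_rate:
  assumes G: "\<And>y. y \<in> S \<Longrightarrow> 0 \<le> G x y" "\<And>y. y \<in> S \<Longrightarrow> G x y \<le> C"
    and nonneg: "\<And>i y. 1 \<le> i \<Longrightarrow> y \<in> S \<Longrightarrow> 0 \<le> L t i y"
    and bound: "total_moment S L 2 t \<le> ennreal B" and "0 \<le> B" and "x \<in> S"
  defines "d \<equiv> \<lambda>n. \<Sum>i<n. real i * (coag_gain S G L i x t - coag_loss S G L i x t)"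
  shows "d \<longlonglongrightarrow> 0" and "\<bar>d n\<bar> \<le> B * (C * B)"
proof -
  note m2 = second_moment_summable[OF nonneg bound \<open>0 \<le> B\<close>]
  \<comment> \<open>The factor \<open>real i\<close> makes size 0 contribute nothing, whatever the
    unconstrained value \<open>L t 0 y\<close> is.\<close>
  define h where "h y i = real i * G x y * L t i y" for y i
  have "0 \<le> C" using G[OF \<open>x \<in> S\<close>] by linarith
  have h_nonneg: "0 \<le> h y i" if "y \<in> S" for y i
    using that G nonneg[of i y] by (cases i) (auto simp: h_def)
  \<comment> \<open>Since \<open>i \<le> i^2\<close> for \<open>i \<ge> 1\<close> and the kernel is
    at most \<open>C\<close>, the second moment dominates the weighted mass.\<close>
  have h_le: "h y i \<le> C * ((real i)\<^sup>2 * L t i y)" if "y \<in> S" "1 \<le> i" for y i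
  proof -
    have "real i * G x y \<le> (real i)\<^sup>2 * C"
      using that G[OF \<open>y \<in> S\<close>] by (intro mult_mono) (auto simp: power2_eq_square)
    then have "real i * G x y * L t i y \<le> (real i)\<^sup>2 * C * L t i y"
      by (rule mult_right_mono) (use that nonneg in auto)
    then show ?thesis by (simp add: h_def algebra_simps)
  qed
  have Cm2: "(\<lambda>p. C * (case p of (y, i) \<Rightarrow> (real i)\<^sup>2 * L t i y)) summable_on S \<times> {1..}"
    by (intro summable_on_cmult_right m2(1))
  have h_summ: "(\<lambda>(y, i). h y i) summable_on S \<times> {1..}"
    by (rule summable_on_comparison_test[OF Cm2]) (use h_nonneg h_le in auto)
  \<comment> \<open>\<open>P\<close> is the double sum in \<open>coag_loss\<close>, with the sites
    outermost; exchanging the sums turns it into the total of \<open>c\<close>.\<close>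
  define P where "P = (\<Sum>\<^sub>\<infinity>y\<in>S. \<Sum>\<^sub>\<infinity>i\<in>{1..}. h y i)"
  define a where "a i = (real i)\<^sup>2 * L t i x" for i
  define c where "c i = (\<Sum>\<^sub>\<infinity>y\<in>S. h y i)" for i
  have h_swap: "(\<lambda>(i, y). h y i) summable_on {1..} \<times> S"
    using h_summ by (subst (asm) summable_on_swap) simp
  have h_slice: "(\<lambda>y. h y i) summable_on S" for i
  proof (cases "i = 0")
    case False
    then show ?thesis
      using summable_on_SigmaD1[of "\<lambda>i y. h y i" "{1..}" "\<lambda>_. S" i] h_swap h_nonneg by auto
  qed (simp add: h_def)
  have c_summ: "c summable_on {1..}"
    using summable_on_Sigma_banach[of "\<lambda>i y. h y i" "{1..}" "\<lambda>_. S"] h_swap by (simp add: c_def[abs_def])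
  have P_eq: "P = (\<Sum>\<^sub>\<infinity>i\<in>{1..}. c i)"
    unfolding P_def c_def by (rule infsum_swap_banach[OF h_summ])
  have c_sums: "c sums P"
    unfolding P_eq by (rule summable_on_atLeast_1_imp_sums[OF c_summ]) (simp add: c_def h_def)
  have P_le: "P \<le> C * B"
  proof -
    have "P = (\<Sum>\<^sub>\<infinity>(y, i)\<in>S \<times> {1..}. h y i)"
      unfolding P_def by (rule infsum_Sigma'_banach[OF h_summ])
    also have "\<dots> \<le> (\<Sum>\<^sub>\<infinity>p\<in>S \<times> {1..}. C * (case p of (y, i) \<Rightarrow> (real i)\<^sup>2 * L t i y))"
      by (rule infsum_mono[OF h_summ Cm2]) (use h_le in auto)
    also have "\<dots> \<le> C * B"
      using m2(2) \<open>0 \<le> C\<close> by (simp add: infsum_cmult_right' mult_left_mono)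
    finally show ?thesis .
  qed
  have a_summ: "a summable_on {1..}"
    using summable_on_SigmaD1[of "\<lambda>y i. (real i)\<^sup>2 * L t i y" S "\<lambda>_. {1..}" x] m2(1) nonneg \<open>x \<in> S\<close>
    by (auto simp: a_def[abs_def])
  have a_sums: "a sums (\<Sum>\<^sub>\<infinity>i\<in>{1..}. a i)"
    by (rule summable_on_atLeast_1_imp_sums[OF a_summ]) (simp add: a_def)
  have a_le: "(\<Sum>\<^sub>\<infinity>i\<in>{1..}. a i) \<le> B"
  proof (rule infsum_le_finite_sums[OF a_summ])
    fix F :: "nat set" assume F: "finite F" "F \<subseteq> {1..}"
    have "sum a F = (\<Sum>(y, i)\<in>{x} \<times> F. (real i)\<^sup>2 * L t i y)"
      by (simp add: a_def flip: sum.cartesian_product)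
    also have "\<dots> \<le> (\<Sum>\<^sub>\<infinity>(y, i)\<in>S \<times> {1..}. (real i)\<^sup>2 * L t i y)"
      by (rule finite_sum_le_infsum[OF m2(1)]) (use F \<open>x \<in> S\<close> nonneg in auto)
    finally show "sum a F \<le> B" using m2(2) by linarith
  qed
  have a_nonneg: "0 \<le> a i" for i
    using nonneg[of i x] \<open>x \<in> S\<close> by (cases i) (auto simp: a_def)
  have c_nonneg: "0 \<le> c i" for i
    unfolding c_def by (rule infsum_nonneg) (rule h_nonneg)
  \<comment> \<open>The factor \<open>real i\<close> cancels the denominator of
    \<open>j / i\<close>; then \<open>j * j\<close> goes into \<open>a j\<close>, and
    \<open>i - j\<close> with the kernel into \<open>h y (i - j)\<close>.\<close>
  have gain: "real i * coag_gain S G L i x t = (\<Sum>j\<le>i. a j * c (i - j))" for i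
  proof (cases "i = 0")
    case False
    have "real i * coag_gain S G L i x t = (\<Sum>\<^sub>\<infinity>y\<in>S. real i * (\<Sum>j=1..<i.
        real j / real i * (real j * real (i - j)) * G x y * L t j x * L t (i - j) y))"
      unfolding coag_gain_def by (simp add: infsum_cmult_right')
    also have "\<dots> = (\<Sum>\<^sub>\<infinity>y\<in>S. \<Sum>j=1..<i. a j * h y (i - j))"
      using False
      by (intro infsum_cong) (simp add: sum_distrib_left a_def h_def power2_eq_square mult_ac)
    also have "\<dots> = (\<Sum>j=1..<i. a j * c (i - j))"
      unfolding c_def
      by (intro infsumI has_sum_finite_sum has_sum_cmult_right has_sum_infsum h_slice) simp
    \<comment> \<open>The added end terms vanish because \<open>a 0 = 0\<close> and
      \<open>c 0 = 0\<close>.\<close>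
    also have "\<dots> = (\<Sum>j\<le>i. a j * c (i - j))"
    proof (rule sum.mono_neutral_left)
      show "\<forall>j\<in>{..i} - {1..<i}. a j * c (i - j) = 0"
      proof
        fix j assume "j \<in> {..i} - {1..<i}"
        then have "j = 0 \<or> j = i" by auto
        then show "a j * c (i - j) = 0" by (auto simp: a_def c_def h_def)
      qed
    qed auto
    finally show ?thesis .
  qed (simp add: a_def)
  have loss: "real i * coag_loss S G L i x t = a i * P" for i
    by (simp add: coag_loss_def P_def h_def a_def power2_eq_square)
  have d_eq: "d n = (\<Sum>i<n. \<Sum>j\<le>i. a j * c (i - j)) - (\<Sum>i<n. a i) * P" for n
    by (simp add: d_def right_diff_distrib gain loss sum_subtractf sum_distrib_right)
  note trunc = Cauchy_product_truncation[OF a_nonneg c_nonneg a_sums c_sums]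
  show "d \<longlonglongrightarrow> 0" using trunc(1) by (simp add: d_eq[abs_def])
  have "\<bar>d n\<bar> \<le> (\<Sum>\<^sub>\<infinity>i\<in>{1..}. a i) * P" using trunc(2) by (simp add: d_eq)
  also have "\<dots> \<le> B * (C * B)"
    using a_le P_le \<open>0 \<le> B\<close> c_nonneg by (intro mult_mono) (auto simp: P_eq infsum_nonneg)
  finally show "\<bar>d n\<bar> \<le> B * (C * B)" .
qed

text \<open>The truncated masses \<open>A n\<close> are differentiable finite sums. Integrating
  their rates over \<open>{0..T}\<close> and letting \<open>n\<close> tend to infinity shows that
  the full mass at time \<open>T\<close> equals the mass at time 0.\<close>

lemma coag_solution_site_mass:
  assumes ker: "spatial_kernel S G" and sol: "coag_solution S G L"
    and "x \<in> S" and "0 \<le> T" and T: "ereal T < gel_time S L"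
  shows "(\<Sum>\<^sub>\<infinity>i\<in>{1..}. real i * L T i x) = L 0 1 x"
proof -
  obtain C where G: "\<And>y. y \<in> S \<Longrightarrow> 0 \<le> G x y" "\<And>y. y \<in> S \<Longrightarrow> G x y \<le> C"
    using ker \<open>x \<in> S\<close> unfolding spatial_kernel_def by (meson less_imp_le)
  have before: "ereal t < gel_time S L" if "t \<in> {0..T}" for t
    using that T by (metis atLeastAtMost_iff ereal_less_eq(3) order_le_less_trans)
  have nonneg: "0 \<le> L t i y" if "t \<in> {0..T}" "1 \<le> i" "y \<in> S" for t i y
    using sol that before[of t] unfolding coag_solution_def by auto
  obtain B0 :: ennreal where "B0 < \<infinity>" and B0: "\<And>t. t \<in> {0..T} \<Longrightarrow> total_moment S L 2 t \<le> B0"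
    using sol \<open>0 \<le> T\<close> T unfolding coag_solution_def by (metis order_refl)
  then obtain B where B: "0 \<le> B" "\<And>t. t \<in> {0..T} \<Longrightarrow> total_moment S L 2 t \<le> ennreal B"
    by (cases B0) auto
  define A where "A n t = (\<Sum>i<n. real i * L t i x)" for n t
  define d where
    "d n t = (\<Sum>i<n. real i * (coag_gain S G L i x t - coag_loss S G L i x t))" for n t
  have deriv: "(A n has_real_derivative d n t) (at t within {0..T})" if "t \<in> {0..T}" for n t
    unfolding A_def[abs_def] d_def
  proof (rule DERIV_sum)
    fix i
    show "((\<lambda>t. real i * L t i x) has_real_derivative
        real i * (coag_gain S G L i x t - coag_loss S G L i x t)) (at t within {0..T})"
    \<comment> \<open>The equation is available for sizes from 1 on; at size 0 the coefficient
      \<open>real i\<close> makes the function constantly 0.\<close>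
    proof (cases "i = 0")
      case False
      then have "((\<lambda>s. L s i x) has_real_derivative coag_gain S G L i x t - coag_loss S G L i x t)
          (at t within {0..})"
        using sol that before[OF that] \<open>x \<in> S\<close> unfolding coag_solution_def by auto
      then have "((\<lambda>s. L s i x) has_real_derivative coag_gain S G L i x t - coag_loss S G L i x t)
          (at t within {0..T})"
        by (rule DERIV_subset) auto
      then show ?thesis by (rule DERIV_cmult)
    qed simp
  qed
  have int: "(d n has_integral A n T - A n 0) {0..T}" for n
    by (rule fundamental_theorem_of_calculus[OF \<open>0 \<le> T\<close>])
      (use deriv in \<open>simp flip: has_real_derivative_iff_has_vector_derivative\<close>)
  \<comment> \<open>The second moment is bounded by one \<open>B\<close> on all of
    \<open>{0..T}\<close>, so a constant dominates every \<open>d n\<close>.\<close>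
  have "(\<lambda>n. integral {0..T} (d n)) \<longlonglongrightarrow> integral {0..T} (\<lambda>_. 0)"
  proof (rule dominated_convergence(2))
    show "d n integrable_on {0..T}" for n using int by blast
    show "(\<lambda>_. B * (C * B)) integrable_on {0..T}" by (rule integrable_const_ivl)
    fix t assume t: "t \<in> {0..T}"
    note rate = truncated_mass_rate[where G = G and L = L and x = x and t = t,
        OF G nonneg[OF t] B(2)[OF t] B(1) \<open>x \<in> S\<close>]
    show "norm (d n t) \<le> B * (C * B)" for n using rate(2) by (simp add: d_def)
    show "(\<lambda>n. d n t) \<longlonglongrightarrow> 0" using rate(1) by (simp add: d_def)
  qed
  then have diff: "(\<lambda>n. A n T - A n 0) \<longlonglongrightarrow> 0"
    using integral_unique[OF int] by simp
  have mass_summ: "(\<lambda>i. real i * L t i x) summable_on {1..}" if t: "t \<in> {0..T}" for t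
  proof -
    have "(\<lambda>i. (real i)\<^sup>2 * L t i x) summable_on {1..}"
      using summable_on_SigmaD1[of "\<lambda>y i. (real i)\<^sup>2 * L t i y" S "\<lambda>_. {1..}" x]
        second_moment_summable(1)[where L = L and t = t, OF nonneg[OF t] B(2)[OF t] B(1)]
        nonneg[OF t] \<open>x \<in> S\<close>
      by auto
    then show ?thesis
      by (rule summable_on_comparison_test)
        (use nonneg[OF t] \<open>x \<in> S\<close> in \<open>auto intro!: mult_right_mono self_le_power\<close>)
  qed
  have lim: "(\<lambda>n. A n t) \<longlonglongrightarrow> (\<Sum>\<^sub>\<infinity>i\<in>{1..}. real i * L t i x)" if "t \<in> {0..T}" for t
    using summable_on_atLeast_1_imp_sums[OF mass_summ[OF that]] by (simp add: A_def sums_def)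
  have "(\<lambda>n. A n T - A n 0) \<longlonglongrightarrow>
      (\<Sum>\<^sub>\<infinity>i\<in>{1..}. real i * L T i x) - (\<Sum>\<^sub>\<infinity>i\<in>{1..}. real i * L 0 i x)"
    using \<open>0 \<le> T\<close> by (intro tendsto_diff lim) auto
  from LIMSEQ_unique[OF diff this]
  have "(\<Sum>\<^sub>\<infinity>i\<in>{1..}. real i * L T i x) = (\<Sum>\<^sub>\<infinity>i\<in>{1..}. real i * L 0 i x)"
    by simp
  also have "\<dots> = L 0 1 x"
  proof (rule infsumI, rule has_sum_if_infsum_ennreal_eq)
    show "(\<Sum>\<^sub>\<infinity>i\<in>{1..}. ennreal (real i * L 0 i x)) = ennreal (L 0 1 x)"
      using sol \<open>x \<in> S\<close> unfolding coag_solution_def monodisperse_init_def site_moment_def by simp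
  qed (use nonneg \<open>0 \<le> T\<close> \<open>x \<in> S\<close> in auto)
  finally show ?thesis .
qed

section \<open>The linear equation and its integrated form\<close>

theorem theorem3p2:
  fixes S :: "'a set"
    and G :: "'a \<Rightarrow> 'a \<Rightarrow> real"
    and L :: "real \<Rightarrow> nat \<Rightarrow> 'a \<Rightarrow> real"
    and T1 :: real
  assumes "countable S"
    and "spatial_kernel S G"
    and "coag_solution S G L"
    and "moment_control S G L T1"
  shows "(\<forall>k\<ge>1. \<forall>x\<in>S. \<forall>t\<in>{0..<T1}.
            \<exists>D. ((\<lambda>s. L s k x) has_real_derivative D) (at t within {0..<T1}) \<and>
                D + real k * coag_rate S G L x * L t k x = coag_source S G L k x t) \<and>
         (\<forall>k\<ge>1. \<forall>x\<in>S. \<forall>t\<in>{0..<T1}.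
            (\<lambda>s. exp (real k * s * coag_rate S G L x) * coag_source S G L k x s)
              integrable_on {0..t} \<and>
            L t k x = exp (- real k * t * coag_rate S G L x) *
              (L 0 k x + integral {0..t}
                 (\<lambda>s. exp (real k * s * coag_rate S G L x) * coag_source S G L k x s)))"
proof -
  have before: "ereal t < gel_time S L" if "t \<in> {0..<T1}" for t
    using that assms(4) unfolding moment_control_def
    by (metis atLeastLessThan_iff less_ereal.simps(1) order_less_le_trans)
  have ode: "((\<lambda>s. L s k x) has_real_derivative
      coag_source S G L k x t - real k * coag_rate S G L x * L t k x) (at t within {0..<T1})"
    if "1 \<le> k" "x \<in> S" and t: "t \<in> {0..<T1}" for k x t
  proof -
    have "((\<lambda>s. L s k x) has_real_derivative coag_gain S G L k x t - coag_loss S G L k x t)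
        (at t within {0..})"
      using assms(3) that before[OF t] unfolding coag_solution_def by auto
    then have "((\<lambda>s. L s k x) has_real_derivative coag_gain S G L k x t - coag_loss S G L k x t)
        (at t within {0..<T1})"
      by (rule DERIV_subset) auto
    \<comment> \<open>Termwise identity: \<open>j / k * (j * (k - j))\<close> is
      \<open>j^2 * (k - j) / k\<close>, with \<open>1 / k\<close> moved inside the sum over the
      sites.\<close>
    moreover have "coag_gain S G L k x t = coag_source S G L k x t"
      unfolding coag_gain_def coag_source_def infsum_cmult_right'[symmetric]
      by (intro infsum_cong)
        (simp add: sum_distrib_left sum_divide_distrib power2_eq_square mult_ac)
    \<comment> \<open>Mass conservation enters here: the inner sum is \<open>G x y\<close> times the
      mass at \<open>y\<close>, which still has its initial value \<open>L 0 1 y\<close>. The loss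
      rate is thus constant in time.\<close>
    moreover have "(\<Sum>\<^sub>\<infinity>y\<in>S. \<Sum>\<^sub>\<infinity>j\<in>{1..}. real j * G x y * L t j y) = coag_rate S G L x"
      unfolding coag_rate_def
    proof (rule infsum_cong)
      fix y assume "y \<in> S"
      have "(\<Sum>\<^sub>\<infinity>j\<in>{1..}. real j * G x y * L t j y) = (\<Sum>\<^sub>\<infinity>j\<in>{1..}. G x y * (real j * L t j y))"
        by (simp add: mult_ac)
      also have "\<dots> = G x y * L 0 1 y"
        using coag_solution_site_mass[OF assms(2,3) \<open>y \<in> S\<close> _ before[OF t]] t
        by (simp add: infsum_cmult_right')
      finally show "(\<Sum>\<^sub>\<infinity>j\<in>{1..}. real j * G x y * L t j y) = L 0 1 y * G x y" by simp
    qed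
    ultimately show ?thesis by (simp add: coag_loss_def mult_ac)
  qed
  \<comment> \<open>In the derivative of \<open>exp (k s p) * L s k x\<close> the two terms with
    \<open>k p\<close> cancel, leaving this integrand. The fundamental theorem for the gauge
    integral gives its integrability together with the value.\<close>
  have duhamel: "((\<lambda>s. exp (real k * s * coag_rate S G L x) * coag_source S G L k x s) has_integral
      exp (real k * t * coag_rate S G L x) * L t k x - L 0 k x) {0..t}"
    if "1 \<le> k" "x \<in> S" and t: "t \<in> {0..<T1}" for k x t
  proof -
    let ?p = "coag_rate S G L x"
    have "((\<lambda>s. exp (real k * s * ?p) * L s k x) has_real_derivative
        exp (real k * s * ?p) * coag_source S G L k x s) (at s within {0..t})"
      if s: "s \<in> {0..t}" for s
    proof -
      have "((\<lambda>s. L s k x) has_real_derivative coag_source S G L k x s - real k * ?p * L s k x)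
          (at s within {0..t})"
        by (rule DERIV_subset[OF ode]) (use that t \<open>1 \<le> k\<close> \<open>x \<in> S\<close> in auto)
      then show ?thesis
        by (auto intro!: derivative_eq_intros simp: algebra_simps)
    qed
    then show ?thesis
      using fundamental_theorem_of_calculus[of 0 t "\<lambda>s. exp (real k * s * ?p) * L s k x"] t
      by (simp add: has_real_derivative_iff_has_vector_derivative)
  qed
  show ?thesis
  proof (intro conjI allI impI ballI)
    fix k :: nat and x t assume *: "1 \<le> k" "x \<in> S" "t \<in> {0..<T1}"
    show "\<exists>D. ((\<lambda>s. L s k x) has_real_derivative D) (at t within {0..<T1}) \<and>
        D + real k * coag_rate S G L x * L t k x = coag_source S G L k x t"
      using ode[OF *] by force
    show "(\<lambda>s. exp (real k * s * coag_rate S G L x) * coag_source S G L k x s) integrable_on {0..t}"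
      using duhamel[OF *] by blast
    show "L t k x = exp (- real k * t * coag_rate S G L x) * (L 0 k x + integral {0..t}
        (\<lambda>s. exp (real k * s * coag_rate S G L x) * coag_source S G L k x s))"
      \<comment> \<open>Solving the integrated identity for \<open>L t k x\<close> amounts to
        dividing by the positive integrating factor.\<close>
      using integral_unique[OF duhamel[OF *]] by (simp add: exp_minus field_simps)
  qed
qed

end
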